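(* Let $m>s>n\ge 1$ be integers, let $A\in\mathbb{R}^{m\times n}$ have linearly independent columns, let $S\in\mathbb{R}^{s\times m}$ have linearly independent rows, and assume $SA$ has full column rank. Let $b\in\mathbb{R}^m$, and let $A=Q_AR_A$ be the economized QR factorization of $A$. Assume $$\kappa_2(SQ_A)<49,\qquad n^2u<\tfrac{1}{201},\qquad \frac{m}{n}+\sqrt n>200,\qquad \kappa_2(A)<\frac{1}{3C_1k(S)},$$ where $$C_1=\sqrt{sn}\,\gamma_m+\sqrt n\,\tilde\gamma_{sn}\,(1+\sqrt{sn}\,\gamma_m),\qquad k(S)=\|S\|_2\,\|(SQ_A)^\dagger\|_2 .$$ Apply the sketch-and-apply algorithm to $\min_x\|Ax-b\|_2$ in floating-point arithmetic with unit round-off $u$: compute $\hat B$ from the product $SA$; compute the triangular factor $\hat R$ of $\hat B$ by Householder QR; compute $\hat Y$ from $A\hat R^{-1}$ by forward substitution; apply LSQR (without preconditioner) to $\hat Yz=b$, obtaining $\hat z$; compute $\hat x$ from $\hat Rx=\hat z$ by back substitution. Assume that the LSQR output satisfies, for some $\Delta\hat Y\in\mathbb{R}^{m\times n}$ and $\delta b\in\mathbb{R}^m$, $$\hat z=(\hat Y+\Delta\hat Y)^\dagger(b+\delta b).$$ Then there is a matrix $\Delta A\in\mathbb{R}^{m\times n}$ such that $\hat x$ is a least squares solution of $(A+\Delta A)x=b+\delta b$, i.e. $\hat x$ minimizes $\|(A+\Delta A)x-(b+\delta b)\|_2$ over $x\in\mathbb{R}^n$, and $$\|\Delta A\|_2<\|S\|_2\|A\|_2\left(6.04\,n\gamma_n\|(SQ_A)^\dagger\|_2+2.01\,\|\Delta\hat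 Y\|_2\right).$$
   Context: Notation: $\|\cdot\|_2$ is the spectral norm, $\|\cdot\|_F$ the Frobenius norm, $M^\dagger$ the Moore–Penrose pseudoinverse, $\kappa_2(M)=\sigma_{\max}(M)/\sigma_{\min}(M)$, and $|M|$ the entrywise absolute value (inequalities between such matrices are entrywise). An economized QR factorization of a full-column-rank $m\times n$ matrix is $QR$ with $Q\in\mathbb{R}^{m\times n}$ having orthonormal columns and $R\in\mathbb{R}^{n\times n}$ upper triangular. Rounding constants: $u>0$ is the unit round-off, $\gamma_k=\frac{ku}{1-ku}$ and $\tilde\gamma_{k}=\frac{cku}{1-cku}$, where $c\ge1$ is a fixed small integer constant (coming from the error analysis of Householder QR); it is implicitly assumed that all denominators are positive, i.e. $mu<1$ and $csnu<1$. Floating-point model (the meaning of "computed"): (1) Matrix product: $\hat B=SA+E_1$ with $\|E_1\|_2\le\gamma_m\sqrt{sn}\,\|S\|_2\|A\|_2$. (2) Householder QR: $\hat R\in\mathbb{R}^{n\times n}$ is upper triangular and there is $\tilde Q\in\mathbb{R}^{s\times n}$ with orthonormal columns such that $\tilde Q\hat R=\hat B+E_2$ with $\|E_2\|_F\le\tilde\gamma_{sn}\|\hat B\|_F$. (3) Forward substitution: with $a_i^T$ and $\hat y_i^T$ the $i$th rows of $A$ and $\hat Y$, for each $i$ there is $\Delta_i\in\mathbb{R}^{n\times n}$ with $\hat y_i^T(\hat R+\Delta_i)=a_i^T$ and $|\Delta_i|\le\gamma_n|\hat R|$. Consequently, when $\sqrt n\gamma_n\kappa_2(\hat R)<1$,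 $\|\hat Y-A\hat R^{-1}\|_F\le\frac{\sqrt n\gamma_n\kappa_2(\hat R)}{1-\sqrt n\gamma_n\kappa_2(\hat R)}\|A\hat R^{-1}\|_F$. (4) Back substitution: $(\hat R+\Delta\hat R)\hat x=\hat z$ with $\|\Delta\hat R\|_2\le\gamma_n\sqrt n\,\|\hat R\|_2$. *)

theory Defs
  imports "HOL-Analysis.Analysis"
begin

text \<open>
  A \<open>p \<times> q\<close> matrix has type \<open>real^'q^'p\<close> (rows indexed by \<open>'p\<close>), with
  \<open>p = CARD('p)\<close> and \<open>q = CARD('q)\<close>. The column index type of a triangular matrix
  carries a linear order, so that it is an ordered copy of \<open>{1..n}\<close>.
\<close>

text \<open>The operator norm with respect to the Euclidean norms.\<close>

abbreviation spectral_norm :: "real^'q^'p \<Rightarrow> real" where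
  "spectral_norm M \<equiv> onorm ((*v) M)"

text \<open>
  The norm of the type \<open>real^'q^'p\<close> is the Euclidean norm of the vector of the Euclidean
  norms of the rows, i.e. the square root of the sum of the squares of all entries.
\<close>

abbreviation frobenius_norm :: "real^'q^'p \<Rightarrow> real" where
  "frobenius_norm M \<equiv> norm M"

definition lin_indep_columns :: "real^'q^'p \<Rightarrow> bool" where
  "lin_indep_columns M \<longleftrightarrow>
     (\<forall>c :: 'q \<Rightarrow> real. (\<Sum>j\<in>UNIV. c j *\<^sub>R column j M) = 0 \<longrightarrow> (\<forall>j. c j = 0))"

definition lin_indep_rows :: "real^'q^'p \<Rightarrow> bool" where
  "lin_indep_rows M \<longleftrightarrow>
     (\<forall>c :: 'p \<Rightarrow> real. (\<Sum>i\<in>UNIV. c i *\<^sub>R row i M) = 0 \<longrightarrow> (\<forall>i. c i = 0))"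

definition orthonormal_columns :: "real^'q^'p \<Rightarrow> bool" where
  "orthonormal_columns Q \<longleftrightarrow> transpose Q ** Q = mat 1"

definition upper_triangular :: "real^('n::{finite,linorder})^('n::{finite,linorder}) \<Rightarrow> bool" where
  "upper_triangular R \<longleftrightarrow> (\<forall>i j. j < i \<longrightarrow> R $ i $ j = 0)"

definition economized_QR ::
  "real^('n::{finite,linorder})^'m \<Rightarrow> real^('n::{finite,linorder})^'m \<Rightarrow> real^('n::{finite,linorder})^('n::{finite,linorder}) \<Rightarrow> bool" where
  "economized_QR A Q R \<longleftrightarrow> A = Q ** R \<and> orthonormal_columns Q \<and> upper_triangular R"

text \<open>
  The unique matrix satisfying the four Penrose conditions.
\<close>

definition pinv :: "real^'q^'p \<Rightarrow> real^'p^'q" where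
  "pinv M = (THE X. M ** X ** M = M \<and> X ** M ** X = X \<and>
                    transpose (M ** X) = M ** X \<and> transpose (X ** M) = X ** M)"

text \<open>
  Singular values are given by pairs of left and right singular vectors. Requiring both
  vectors gives the \<open>min p q\<close> singular values of a \<open>p \<times> q\<close> matrix: a matrix of full rank
  does not have the singular value \<open>0\<close>, whatever its shape.
\<close>

definition singular_values :: "real^'q^'p \<Rightarrow> real set" where
  "singular_values M = {\<sigma>. 0 \<le> \<sigma> \<and>
     (\<exists>v w. norm v = 1 \<and> norm w = 1 \<and> M *v v = \<sigma> *\<^sub>R w \<and> transpose M *v w = \<sigma> *\<^sub>R v)}"

definition sigma_max :: "real^'q^'p \<Rightarrow> real" where
  "sigma_max M = Max (singular_values M)"

definition sigma_min :: "real^'q^'p \<Rightarrow> real" where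
  "sigma_min M = Min (singular_values M)"

definition kappa2 :: "real^'q^'p \<Rightarrow> real" where
  "kappa2 M = sigma_max M / sigma_min M"

definition least_squares_solution :: "real^'n^'m \<Rightarrow> real^'m \<Rightarrow> real^'n \<Rightarrow> bool" where
  "least_squares_solution M d x \<longleftrightarrow> (\<forall>y. norm (M *v x - d) \<le> norm (M *v y - d))"

definition gam :: "real \<Rightarrow> nat \<Rightarrow> real" where
  "gam u k = real k * u / (1 - real k * u)"

definition gamt :: "nat \<Rightarrow> real \<Rightarrow> nat \<Rightarrow> real" where
  "gamt c u k = real (c * k) * u / (1 - real (c * k) * u)"

definition computed_product ::
  "real \<Rightarrow> real^'m^'s \<Rightarrow> real^'n^'m \<Rightarrow> real^'n^'s \<Rightarrow> bool" where
  "computed_product u S A Bhat \<longleftrightarrow>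
     (\<exists>E1. Bhat = S ** A + E1 \<and>
        spectral_norm E1
          \<le> gam u CARD('m) * sqrt (real (CARD('s) * CARD('n))) * spectral_norm S * spectral_norm A)"

definition computed_QR_factor ::
  "nat \<Rightarrow> real \<Rightarrow> real^('n::{finite,linorder})^'s \<Rightarrow> real^('n::{finite,linorder})^('n::{finite,linorder}) \<Rightarrow> bool" where
  "computed_QR_factor c u Bhat Rhat \<longleftrightarrow>
     upper_triangular Rhat \<and>
     (\<exists>(Qt :: real^('n::{finite,linorder})^'s) E2. orthonormal_columns Qt \<and> Qt ** Rhat = Bhat + E2 \<and>
        frobenius_norm E2 \<le> gamt c u (CARD('s) * CARD('n)) * frobenius_norm Bhat)"

text \<open>
  Rowwise backward error of the triangular solves \<open>y\<^sub>i\<^sup>T R = a\<^sub>i\<^sup>T\<close>. On matrices,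
  \<open>\<bar>_\<bar>\<close> and \<open>\<le>\<close> are the entrywise absolute value and order.
\<close>

definition computed_forward_substitution ::
  "real \<Rightarrow> real^'n^'m \<Rightarrow> real^'n^'n \<Rightarrow> real^'n^'m \<Rightarrow> bool" where
  "computed_forward_substitution u A Rhat Yhat \<longleftrightarrow>
     (\<forall>i. \<exists>\<Delta> :: real^'n^'n. row i Yhat v* (Rhat + \<Delta>) = row i A \<and>
        \<bar>\<Delta>\<bar> \<le> gam u CARD('n) *\<^sub>R \<bar>Rhat\<bar>)"

definition computed_back_substitution ::
  "real \<Rightarrow> real^'n^'n \<Rightarrow> real^'n \<Rightarrow> real^'n \<Rightarrow> bool" where
  "computed_back_substitution u Rhat zhat xhat \<longleftrightarrow>
     (\<exists>\<Delta>R. (Rhat + \<Delta>R) *v xhat = zhat \<and>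
        spectral_norm \<Delta>R \<le> gam u CARD('n) * sqrt (real CARD('n)) * spectral_norm Rhat)"

definition C1 :: "nat \<Rightarrow> real \<Rightarrow> nat \<Rightarrow> nat \<Rightarrow> nat \<Rightarrow> real" where
  "C1 c u m s n = sqrt (real (s * n)) * gam u m
     + sqrt (real n) * gamt c u (s * n) * (1 + sqrt (real (s * n)) * gam u m)"

definition k_sketch :: "real^'m^'s \<Rightarrow> real^'n^'m \<Rightarrow> real" where
  "k_sketch S Q = spectral_norm S * spectral_norm (pinv (S ** Q))"

end

theory Submission
  imports Defs
begin

text \<open>
  Take \<open>A + \<Delta>A = (Yhat + \<Delta>Yhat) (Rhat + \<Delta>R)\<close> with the back substitution error \<open>\<Delta>R\<close>: as
  \<open>zhat\<close> solves the least squares problem with matrix \<open>Yhat + \<Delta>Yhat\<close>, \<open>xhat\<close> solves the one with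
  \<open>A + \<Delta>A\<close>, whatever the rank of \<open>Yhat + \<Delta>Yhat\<close>. Then
  \<open>\<Delta>A = (Yhat Rhat - A) + \<Delta>Yhat Rhat + (Yhat + \<Delta>Yhat) \<Delta>R\<close>, and it remains to bound \<open>Rhat\<close> and \<open>Yhat\<close>.
  With \<open>E\<close> the accumulated error of the product and the QR factorization and \<open>P = (S Q\<^sub>A)\<^sup>\<dagger>\<close>,
  \<open>\<parallel>Rhat x\<parallel> = \<parallel>(S A + E) x\<parallel>\<close> with \<open>\<parallel>E\<parallel> \<le> C1 \<parallel>S\<parallel> \<parallel>A\<parallel>\<close>, and \<open>C1 k(S) \<kappa>(A) < 1/3\<close> gives
  \<open>\<parallel>Rhat\<parallel> \<le> 4/3 \<parallel>S\<parallel> \<parallel>A\<parallel>\<close> and \<open>\<parallel>A Rhat\<^sup>-\<^sup>1\<parallel> \<le> 3/2 \<parallel>P\<parallel>\<close>. The assumption on \<open>m/n + \<surd>n\<close> makes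
  \<open>n \<gamma>\<^sub>n\<close> small against \<open>C1\<close>, hence \<open>n \<gamma>\<^sub>n \<kappa>(Rhat) < 1/200\<close>, so that \<open>\<parallel>Yhat\<parallel>\<close> is hardly larger
  than \<open>\<parallel>A Rhat\<^sup>-\<^sup>1\<parallel>\<close>.
\<close>

subsection \<open>Spectral and Frobenius norms\<close>

lemma matrix_mult_add_rdistrib:
  fixes M N :: "'a::semiring_1^'q^'p" and K :: "'a^'r^'q"
  shows "(M + N) ** K = M ** K + N ** K"
  by (simp add: matrix_matrix_mult_def vec_eq_iff distrib_right sum.distrib)

lemma inner_matrix_vector_mult:
  fixes M :: "real^'q^'p"
  shows "(M *v x) \<bullet> y = x \<bullet> (transpose M *v y)"
  by (metis dot_lmul_matrix inner_commute transpose_matrix_vector)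

lemma norm_matrix_vector_mult_le:
  fixes M :: "real^'q^'p"
  shows "norm (M *v x) \<le> spectral_norm M * norm x"
  by (rule onorm) (rule matrix_vector_mul_bounded_linear)

lemma spectral_norm_nonneg: "0 \<le> spectral_norm (M :: real^'q^'p)"
  by (rule onorm_pos_le) (rule matrix_vector_mul_bounded_linear)

lemma spectral_norm_add_le:
  fixes M N :: "real^'q^'p"
  shows "spectral_norm (M + N) \<le> spectral_norm M + spectral_norm N"
  using onorm_triangle[OF matrix_vector_mul_bounded_linear matrix_vector_mul_bounded_linear, of M N]
  by (simp add: matrix_vector_mult_add_rdistrib[symmetric])

lemma spectral_norm_mult_le:
  fixes M :: "real^'q^'p" and N :: "real^'r^'q"
  shows "spectral_norm (M ** N) \<le> spectral_norm M * spectral_norm N"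
  using onorm_compose[OF matrix_vector_mul_bounded_linear matrix_vector_mul_bounded_linear, of M N]
  by (simp add: o_def matrix_vector_mul_assoc)

text \<open>Cauchy--Schwarz applied to \<open>x \<bullet> (M *v (transpose M *v x))\<close>, the
  square of the norm to be bounded, leaves one factor of that norm to cancel.\<close>

lemma spectral_norm_transpose_le:
  fixes M :: "real^'q^'p"
  shows "spectral_norm (transpose M) \<le> spectral_norm M"
proof (rule onorm_le)
  fix x
  let ?y = "transpose M *v x"
  have "norm ?y * norm ?y = x \<bullet> (M *v ?y)"
    by (metis inner_matrix_vector_mult norm_eq_square power2_eq_square power2_norm_eq_inner transpose_transpose)
  also have "\<dots> \<le> norm x * (spectral_norm M * norm ?y)"
    by (meson norm_cauchy_schwarz norm_matrix_vector_mult_le mult_left_mono norm_ge_zero order_trans)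
  finally have "norm ?y * norm ?y \<le> (spectral_norm M * norm x) * norm ?y"
    by (simp add: mult_ac)
  then show "norm ?y \<le> spectral_norm M * norm x"
    by (metis mult_nonneg_nonneg mult_right_le_imp_le norm_ge_zero order_le_less spectral_norm_nonneg)
qed

lemma frobenius_norm_power2: "(frobenius_norm (M :: real^'q^'p))\<^sup>2 = (\<Sum>i\<in>UNIV. (norm (M $ i))\<^sup>2)"
  by (simp add: norm_vec_def L2_set_def sum_nonneg)

lemma frobenius_norm_transpose: "frobenius_norm (transpose M) = frobenius_norm (M :: real^'q^'p)"
proof -
  have "(frobenius_norm (transpose M))\<^sup>2 = (frobenius_norm M)\<^sup>2"
    unfolding frobenius_norm_power2 norm_vec_def L2_set_def transpose_def
    by (simp add: sum_nonneg) (rule sum.swap)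
  then show ?thesis by simp
qed

lemma spectral_norm_le_frobenius_norm:
  fixes M :: "real^'q^'p"
  shows "spectral_norm M \<le> frobenius_norm M"
proof (rule onorm_le)
  fix x
  have "(norm (M *v x))\<^sup>2 = (\<Sum>i\<in>UNIV. (M $ i \<bullet> x)\<^sup>2)"
    by (simp add: norm_vec_def L2_set_def sum_nonneg matrix_vector_mul_component)
  also have "\<dots> \<le> (\<Sum>i\<in>UNIV. (norm (M $ i))\<^sup>2 * (norm x)\<^sup>2)"
    by (intro sum_mono) (metis Cauchy_Schwarz_ineq power2_norm_eq_inner)
  also have "\<dots> = (frobenius_norm M * norm x)\<^sup>2"
    by (simp add: frobenius_norm_power2 power_mult_distrib sum_distrib_right)
  finally show "norm (M *v x) \<le> norm M * norm x"
    by (rule power2_le_imp_le) simp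
qed

text \<open>Every column is the image of a unit vector, so its norm is at most the spectral norm;
  the squares are summed over the columns.\<close>

lemma frobenius_norm_le_sqrt_spectral_norm:
  fixes M :: "real^'q^'p"
  shows "frobenius_norm M \<le> sqrt (real CARD('q)) * spectral_norm M"
proof (rule power2_le_imp_le)
  have "(frobenius_norm M)\<^sup>2 = (\<Sum>j\<in>UNIV. (norm (transpose M $ j))\<^sup>2)"
    by (metis frobenius_norm_power2 frobenius_norm_transpose)
  also have "\<dots> \<le> (\<Sum>j\<in>(UNIV::'q set). (spectral_norm M)\<^sup>2)"
  proof (intro sum_mono power_mono)
    fix j
    have "transpose M $ j = column j M"
      by (simp add: transpose_def column_def)
    then show "norm (transpose M $ j) \<le> spectral_norm M"
      by (simp add: norm_column_le_onorm)
  qed simp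
  finally show "(frobenius_norm M)\<^sup>2 \<le> (sqrt (real CARD('q)) * spectral_norm M)\<^sup>2"
    by (simp add: power_mult_distrib)
qed (simp add: spectral_norm_nonneg)

lemma norm_orthonormal_columns_mult:
  fixes Q :: "real^'q^'p"
  assumes "orthonormal_columns Q"
  shows "norm (Q *v x) = norm x"
proof -
  have "(Q *v x) \<bullet> (Q *v x) = x \<bullet> x"
    using assms by (simp add: inner_matrix_vector_mult matrix_vector_mul_assoc orthonormal_columns_def)
  then show ?thesis by (simp add: norm_eq_sqrt_inner)
qed

subsection \<open>Moore--Penrose pseudoinverse\<close>

text \<open>A linear map has a linear right inverse on its range, whatever its rank.\<close>

lemma matrix_inner_inverse_exists:
  fixes M :: "real^'q^'p"
  shows "\<exists>H. M ** H ** M = M"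
proof -
  obtain g where g: "linear g" "\<And>x. M *v g (M *v x) = M *v x"
    using linear_exists_right_inverse_on[OF matrix_vector_mul_linear subspace_UNIV, of M] by auto
  have "(M ** matrix g ** M) *v x = M *v x" for x
    using g by (simp add: matrix_vector_mul_assoc[symmetric] matrix_works)
  then show ?thesis by (metis matrix_eq)
qed

text \<open>\<open>transpose M ** M\<close> and \<open>M\<close> have the same kernel, because the
  quadratic form of the former is the squared norm of \<open>M *v w\<close>.\<close>

lemma transpose_mult_self_cancel:
  fixes M :: "real^'q^'p"
  assumes "transpose M ** M ** X = transpose M ** M ** Y"
  shows "M ** X = M ** Y"
proof -
  have "M *v (X *v z) = M *v (Y *v z)" for z
  proof -
    define w where "w = X *v z - Y *v z"
    have "transpose M *v (M *v w) = 0"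
      using arg_cong[OF assms, of "\<lambda>N. N *v z"]
      by (simp add: w_def matrix_vector_mul_assoc[symmetric] matrix_vector_mult_diff_distrib)
    then have "(M *v w) \<bullet> (M *v w) = 0"
      by (simp add: inner_matrix_vector_mult)
    then show ?thesis by (simp add: w_def matrix_vector_mult_diff_distrib)
  qed
  then show ?thesis by (metis matrix_eq matrix_vector_mul_assoc)
qed

text \<open>With \<open>H\<close> an inner inverse of \<open>transpose M ** M\<close>, the matrix
  \<open>M ** H ** transpose M\<close> is the orthogonal projection onto the range of
  \<open>M\<close>. Its symmetry does not presuppose that of \<open>H\<close>: the projection
  \<open>T\<close> satisfies \<open>transpose T = T ** transpose T\<close>, and the right side is
  symmetric.\<close>

lemma orthogonal_range_projection_exists:
  fixes M :: "real^'q^'p"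
  obtains H where "M ** H ** transpose M ** M = M"
    and "transpose (M ** H ** transpose M) = M ** H ** transpose M"
proof -
  obtain H where "transpose M ** M ** H ** (transpose M ** M) = transpose M ** M"
    using matrix_inner_inverse_exists by metis
  then have "transpose M ** M ** (H ** transpose M ** M) = transpose M ** M ** mat 1"
    by (simp add: matrix_mul_assoc)
  then have "M ** (H ** transpose M ** M) = M ** mat 1"
    by (rule transpose_mult_self_cancel)
  then have H: "M ** H ** transpose M ** M = M"
    by (simp add: matrix_mul_assoc)
  let ?T = "M ** H ** transpose M"
  have "transpose ?T = ?T ** transpose ?T"
    by (simp add: matrix_transpose_mul transpose_transpose matrix_mul_assoc H)
  then have "transpose ?T = ?T"
    by (metis matrix_transpose_mul transpose_transpose)
  with H show ?thesis by (rule that)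
qed

text \<open>The predicate under the definite description in \<open>pinv\<close>, named so that
  existence and uniqueness can be proved before \<open>pinv\<close> is unfolded.\<close>

definition is_pinv :: "real^'q^'p \<Rightarrow> real^'p^'q \<Rightarrow> bool" where
  "is_pinv M X \<longleftrightarrow> M ** X ** M = M \<and> X ** M ** X = X \<and>
     transpose (M ** X) = M ** X \<and> transpose (X ** M) = X ** M"

lemma is_pinv_exists:
  fixes M :: "real^'q^'p"
  shows "\<exists>X. is_pinv M X"
proof -
  obtain H where TM: "M ** H ** transpose M ** M = M"
    and T: "transpose (M ** H ** transpose M) = M ** H ** transpose M"
    by (rule orthogonal_range_projection_exists)
  \<comment> \<open>The same construction for \<open>transpose M\<close> gives the orthogonal
    projection onto the row space of \<open>M\<close>.\<close>
  obtain J where UM: "transpose M ** J ** M ** transpose M = transpose M"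
    and U: "transpose (transpose M ** J ** M) = transpose M ** J ** M"
    using orthogonal_range_projection_exists[of "transpose M"] by (metis transpose_transpose)
  have MU: "M ** (transpose M ** J ** M) = M"
    by (metis U UM matrix_transpose_mul transpose_transpose)
  \<comment> \<open>\<open>M\<^sup>T (M M\<^sup>T)\<^sup>- M (M\<^sup>T M)\<^sup>- M\<^sup>T\<close> is the pseudoinverse for any inner inverses \<open>(M M\<^sup>T)\<^sup>-\<close>, \<open>(M\<^sup>T M)\<^sup>-\<close>.\<close>
  let ?X = "transpose M ** J ** M ** H ** transpose M"
  have 1: "M ** ?X = M ** H ** transpose M"
    using MU by (simp add: matrix_mul_assoc)
  have 2: "?X ** M = transpose M ** J ** M"
    by (metis TM matrix_mul_assoc)
  have 3: "transpose M ** J ** M ** ?X = ?X"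
    using UM by (simp add: matrix_mul_assoc)
  have "is_pinv M ?X"
    unfolding is_pinv_def 1 2 3 using TM T U by simp
  then show ?thesis ..
qed

text \<open>\<open>M ** X\<close> and \<open>M ** Y\<close> are both the orthogonal projection onto
  the range of \<open>M\<close>, and \<open>X ** M\<close> and \<open>Y ** M\<close> both the one
  onto its row space. Each equality follows by transposing a product of the two symmetric
  projections.\<close>

lemma is_pinv_unique:
  assumes X: "is_pinv M X" and Y: "is_pinv M Y"
  shows "X = Y"
proof -
  have MX: "M ** X = M ** Y"
  proof -
    have "M ** X = (M ** Y) ** (M ** X)"
      using Y by (simp add: is_pinv_def matrix_mul_assoc)
    also have "\<dots> = transpose ((M ** X) ** (M ** Y))"
      using X Y by (metis is_pinv_def matrix_transpose_mul)
    also have "\<dots> = M ** Y"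
      using X Y by (simp add: is_pinv_def matrix_mul_assoc)
    finally show ?thesis .
  qed
  have XM: "X ** M = Y ** M"
  proof -
    have "X ** M = (X ** M) ** (Y ** M)"
      using Y by (metis is_pinv_def matrix_mul_assoc)
    also have "\<dots> = transpose ((Y ** M) ** (X ** M))"
      using X Y by (metis is_pinv_def matrix_transpose_mul)
    also have "\<dots> = Y ** M"
      using X Y by (metis is_pinv_def matrix_mul_assoc)
    finally show ?thesis .
  qed
  have "X = X ** M ** X" using X by (simp add: is_pinv_def)
  also have "\<dots> = Y ** M ** Y" using MX XM by (metis matrix_mul_assoc)
  also have "\<dots> = Y" using Y by (simp add: is_pinv_def)
  finally show ?thesis .
qed

lemma is_pinv_pinv: "is_pinv M (pinv M)"
proof -
  have "pinv M = (THE X. is_pinv M X)"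
    by (simp add: pinv_def is_pinv_def)
  also have "is_pinv M \<dots>"
    by (rule theI') (use is_pinv_exists is_pinv_unique in blast)
  finally show ?thesis .
qed

lemma pinv_left_inverse:
  fixes M :: "real^'q^'p"
  assumes "inj ((*v) M)"
  shows "pinv M ** M = mat 1"
proof -
  obtain B where "B ** M = mat 1"
    using assms by (metis matrix_left_invertible_injective)
  then show ?thesis
    using is_pinv_pinv[of M] by (metis is_pinv_def matrix_mul_assoc matrix_mul_lid)
qed

text \<open>The residual at \<open>pinv M *v d\<close> is orthogonal to the range of
  \<open>M\<close>, so Pythagoras applies. The argument covers rank deficient \<open>M\<close>,
  which matters for a perturbed \<open>Yhat\<close>.\<close>

lemma least_squares_solution_pinv:
  fixes M :: "real^'q^'p"
  shows "least_squares_solution M d (pinv M *v d)"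
  unfolding least_squares_solution_def
proof
  fix y
  let ?z = "pinv M *v d"
  have "transpose M ** (M ** pinv M) = transpose M"
    using is_pinv_pinv[of M] by (metis is_pinv_def matrix_transpose_mul)
  then have *: "transpose M *v (M *v ?z - d) = 0"
    by (simp add: matrix_vector_mult_diff_distrib matrix_vector_mul_assoc)
  have "orthogonal (M *v (y - ?z)) (M *v ?z - d)"
    using * by (simp add: orthogonal_def inner_matrix_vector_mult)
  then have "(norm (M *v (y - ?z) + (M *v ?z - d)))\<^sup>2 = (norm (M *v (y - ?z)))\<^sup>2 + (norm (M *v ?z - d))\<^sup>2"
    by (rule norm_add_Pythagorean)
  then have "(norm (M *v ?z - d))\<^sup>2 \<le> (norm (M *v y - d))\<^sup>2"
    by (simp add: matrix_vector_mult_diff_distrib)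
  then show "norm (M *v ?z - d) \<le> norm (M *v y - d)"
    by (rule power2_le_imp_le) simp
qed

subsection \<open>Singular values and the condition number\<close>

text \<open>A zero of a nonnegative quadratic form is a minimum, so the gradient vanishes there;
  otherwise a step from \<open>v\<close> against \<open>B *v v\<close> would make the form
  negative.\<close>

lemma psd_null_vector:
  fixes B :: "real^'q^'q"
  assumes sym: "transpose B = B" and psd: "\<And>x. 0 \<le> x \<bullet> (B *v x)" and v: "v \<bullet> (B *v v) = 0"
  shows "B *v v = 0"
proof (rule ccontr)
  define h where "h = B *v v"
  define a where "a = h \<bullet> h"
  define k where "k = h \<bullet> (B *v h)"
  assume "B *v v \<noteq> 0"
  then have a: "0 < a" by (simp add: a_def h_def)
  have k: "0 \<le> k" unfolding k_def by (rule psd)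
  \<comment> \<open>This step length makes the form equal to \<open>t * (- a - t)\<close>; the
    summand 1 keeps the denominator positive when \<open>k = 0\<close>.\<close>
  define t where "t = a / (k + 1)"
  have t: "0 < t" "t * (k + 1) = a" using a k by (auto simp: t_def)
  have vh: "v \<bullet> (B *v h) = a"
    using sym by (metis a_def h_def inner_matrix_vector_mult)
  have "(v - t *\<^sub>R h) \<bullet> (B *v (v - t *\<^sub>R h)) = - 2 * t * a + t * (t * k)"
    using v by (simp add: matrix_vector_mult_diff_distrib matrix_vector_mult_scaleR inner_diff_left
        inner_diff_right vh k_def[symmetric] h_def[symmetric] a_def[symmetric] algebra_simps)
  also have "\<dots> = t * (- a - t)"
    unfolding t(2)[symmetric] by (simp add: algebra_simps)
  also have "\<dots> < 0" using a t(1) by (simp add: mult_pos_neg)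
  finally show False using psd[of "v - t *\<^sub>R h"] by simp
qed

lemma singular_value_of_eigenvector:
  fixes M :: "real^'q^'p"
  assumes "norm v = 1" and "0 < \<sigma>" and eig: "transpose M *v (M *v v) = \<sigma>\<^sup>2 *\<^sub>R v"
  shows "\<sigma> \<in> singular_values M"
proof -
  have "(norm (M *v v))\<^sup>2 = v \<bullet> (\<sigma>\<^sup>2 *\<^sub>R v)"
    by (metis eig inner_matrix_vector_mult power2_norm_eq_inner)
  then have "(norm (M *v v))\<^sup>2 = \<sigma>\<^sup>2"
    using assms(1) by (metis inner_scaleR_right mult.right_neutral norm_eq_1)
  then have n: "norm (M *v v) = \<sigma>" using assms(2) by simp
  let ?w = "(1 / \<sigma>) *\<^sub>R (M *v v)"
  have "norm ?w = 1" "M *v v = \<sigma> *\<^sub>R ?w"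
    using n assms(2) by auto
  moreover have "transpose M *v ?w = \<sigma> *\<^sub>R v"
    using assms(2) by (simp only: matrix_vector_mult_scaleR eig) (simp add: power2_eq_square)
  ultimately show ?thesis
    using assms unfolding singular_values_def by (intro CollectI conjI exI[of _ v] exI[of _ ?w]) auto
qed

text \<open>Right singular vectors chosen for distinct singular values are orthogonal eigenvectors
  of \<open>transpose M ** M\<close>, hence independent and finite in number. Finiteness gives
  \<open>Max\<close> and \<open>Min\<close> in \<open>sigma_max\<close> and \<open>sigma_min\<close>
  their meaning.\<close>

lemma finite_singular_values:
  fixes M :: "real^'q^'p"
  shows "finite (singular_values M)"
proof -
  let ?P = "\<lambda>\<sigma> v. norm v = 1 \<and> transpose M *v (M *v v) = \<sigma>\<^sup>2 *\<^sub>R v"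
  have "\<exists>v. ?P \<sigma> v" if \<sigma>: "\<sigma> \<in> singular_values M" for \<sigma>
  proof -
    obtain v w where "norm v = 1" "M *v v = \<sigma> *\<^sub>R w" "transpose M *v w = \<sigma> *\<^sub>R v"
      using \<sigma> unfolding singular_values_def by blast
    then have "?P \<sigma> v"
      by (simp only: matrix_vector_mult_scaleR) (simp add: power2_eq_square)
    then show ?thesis ..
  qed
  then obtain f where f: "\<And>\<sigma>. \<sigma> \<in> singular_values M \<Longrightarrow> ?P \<sigma> (f \<sigma>)"
    by metis
  have ortho: "orthogonal (f \<sigma>) (f \<tau>)"
    if "\<sigma> \<in> singular_values M" "\<tau> \<in> singular_values M" "\<sigma> \<noteq> \<tau>" for \<sigma> \<tau>
  proof -
    have "\<sigma>\<^sup>2 * (f \<sigma> \<bullet> f \<tau>) = (transpose M *v (M *v f \<sigma>)) \<bullet> f \<tau>"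
      using f that by simp
    also have "\<dots> = f \<sigma> \<bullet> (transpose M *v (M *v f \<tau>))"
      by (metis inner_matrix_vector_mult transpose_transpose)
    also have "\<dots> = \<tau>\<^sup>2 * (f \<sigma> \<bullet> f \<tau>)"
      using f that by simp
    finally have "(\<sigma>\<^sup>2 - \<tau>\<^sup>2) * (f \<sigma> \<bullet> f \<tau>) = 0"
      by (simp add: algebra_simps)
    moreover have "\<sigma>\<^sup>2 \<noteq> \<tau>\<^sup>2"
      using that by (simp add: singular_values_def)
    ultimately show ?thesis by (simp add: orthogonal_def)
  qed
  have nz: "f \<sigma> \<noteq> 0" if "\<sigma> \<in> singular_values M" for \<sigma>
    using f[OF that] by auto
  have "independent (f ` singular_values M)"
    by (rule pairwise_orthogonal_independent) (use ortho nz in \<open>auto simp: pairwise_def\<close>)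
  then have "finite (f ` singular_values M)"
    by (rule finiteI_independent)
  moreover have "inj_on f (singular_values M)"
    by (rule inj_onI) (metis ortho nz orthogonal_self)
  ultimately show ?thesis by (rule finite_imageD)
qed

text \<open>At a minimum of the quotient of \<open>norm (M *v x)\<close> by \<open>norm x\<close>,
  the matrix \<open>B\<close> formed by shifting \<open>transpose M ** M\<close> by the extremal
  square is positive semidefinite with \<open>v\<close> a zero of its form; at a maximum this holds
  for \<open>- B\<close>.\<close>

lemma eigenvector_of_extremum:
  fixes M :: "real^'q^'p"
  assumes v: "norm v = 1"
    and ext: "(\<forall>x. norm (M *v v) * norm x \<le> norm (M *v x)) \<or>
              (\<forall>x. norm (M *v x) \<le> norm (M *v v) * norm x)"
  shows "transpose M *v (M *v v) = (norm (M *v v))\<^sup>2 *\<^sub>R v"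
proof -
  define B where "B = transpose M ** M - (norm (M *v v))\<^sup>2 *\<^sub>R mat 1"
  have Bx: "B *v x = transpose M *v (M *v x) - (norm (M *v v))\<^sup>2 *\<^sub>R x" for x
    by (simp add: B_def matrix_vector_mult_diff_rdistrib scaleR_matrix_vector_assoc[symmetric]
        matrix_vector_mul_assoc del: transpose_matrix_vector)
  have q: "x \<bullet> (B *v x) = (norm (M *v x))\<^sup>2 - (norm (M *v v) * norm x)\<^sup>2" for x
    unfolding Bx inner_diff_right inner_matrix_vector_mult[symmetric]
    by (simp add: power2_norm_eq_inner power_mult_distrib)
  have sym: "transpose B = B"
    unfolding B_def by (simp add: vec_eq_iff transpose_def matrix_matrix_mult_def mat_def mult.commute)
  have v0: "v \<bullet> (B *v v) = 0" by (simp add: q v)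
  have "B *v v = 0"
    using ext
  proof
    assume "\<forall>x. norm (M *v v) * norm x \<le> norm (M *v x)"
    then show ?thesis
      by (intro psd_null_vector[OF sym _ v0]) (simp add: q power_mono)
  next
    assume *: "\<forall>x. norm (M *v x) \<le> norm (M *v v) * norm x"
    have minus: "(- B) *v x = - (B *v x)" for x
      by (simp add: matrix_vector_mult_def vec_eq_iff sum_negf)
    have "(- B) *v v = 0"
    proof (rule psd_null_vector)
      show "transpose (- B) = - B"
        using sym by (simp add: vec_eq_iff transpose_def)
      show "0 \<le> x \<bullet> (- B *v x)" for x
        using * by (simp add: minus q power_mono)
      show "v \<bullet> (- B *v v) = 0" by (simp add: minus v0)
    qed
    then show ?thesis by (simp add: minus)
  qed
  then show ?thesis by (simp only: Bx) simp
qed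

lemma spectral_norm_attained:
  fixes M :: "real^'q^'p"
  shows "\<exists>v. norm v = 1 \<and> norm (M *v v) = spectral_norm M"
proof -
  have "continuous_on (sphere 0 1) (\<lambda>x. norm (M *v x))"
    by (intro continuous_intros linear_continuous_on_compose matrix_vector_mul_linear)
  then obtain v where v: "v \<in> sphere 0 1" "\<And>x. x \<in> sphere 0 1 \<Longrightarrow> norm (M *v x) \<le> norm (M *v v)"
    using continuous_attains_sup[of "sphere (0::real^'q) 1" "\<lambda>x. norm (M *v x)"] by auto
  have "norm (M *v x) \<le> norm (M *v v) * norm x" for x
  proof (cases "x = 0")
    case False
    have "norm (M *v ((1 / norm x) *\<^sub>R x)) \<le> norm (M *v v)"
      using False by (intro v(2)) simp
    then show ?thesis
      using False by (simp add: matrix_vector_mult_scaleR field_simps)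
  qed simp
  then have "spectral_norm M \<le> norm (M *v v)"
    by (rule onorm_le)
  moreover have "norm (M *v v) \<le> spectral_norm M"
    using norm_matrix_vector_mult_le[of M v] v(1) by simp
  ultimately show ?thesis using v(1) by auto
qed

text \<open>Links the definition of \<open>kappa2\<close> through singular vectors to norm
  estimates. The maximum and the minimum \<mu> of \<open>norm (M *v x)\<close> on the unit sphere
  are singular values, so \<open>sigma_max M\<close> is at least the former and
  \<open>sigma_min M\<close> at most the latter.\<close>

lemma spectral_norm_le_kappa2:
  fixes M :: "real^'q^'p"
  assumes inj: "inj ((*v) M)"
  shows "spectral_norm M * norm x \<le> kappa2 M * norm (M *v x)"
proof -
  have ker: "M *v x = 0 \<Longrightarrow> x = 0" for x
    using inj by (metis injD matrix_vector_mult_0_right)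
  have "continuous_on (sphere 0 1) (\<lambda>x. norm (M *v x))"
    by (intro continuous_intros linear_continuous_on_compose matrix_vector_mul_linear)
  then obtain v where v: "v \<in> sphere 0 1" "\<And>x. x \<in> sphere 0 1 \<Longrightarrow> norm (M *v v) \<le> norm (M *v x)"
    using continuous_attains_inf[of "sphere (0::real^'q) 1" "\<lambda>x. norm (M *v x)"] by auto
  define \<mu> where "\<mu> = norm (M *v v)"
  have lower: "\<mu> * norm x \<le> norm (M *v x)" for x
  proof (cases "x = 0")
    case False
    have "norm (M *v v) \<le> norm (M *v ((1 / norm x) *\<^sub>R x))"
      using False by (intro v(2)) simp
    then show ?thesis
      using False by (simp add: \<mu>_def matrix_vector_mult_scaleR field_simps)
  qed simp
  have v1: "norm v = 1" using v(1) by simp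
  have \<mu>: "0 < \<mu>" using ker[of v] v1 by (auto simp: \<mu>_def)
  have \<mu>_sv: "\<mu> \<in> singular_values M"
    using singular_value_of_eigenvector[OF v1 \<mu>] eigenvector_of_extremum[OF v1] lower
    unfolding \<mu>_def by blast
  obtain w where w: "norm w = 1" "norm (M *v w) = spectral_norm M"
    using spectral_norm_attained by blast
  have "\<mu> \<le> spectral_norm M" using lower[of w] w by simp
  then have "0 < norm (M *v w)" using \<mu> w by simp
  then have norm_sv: "spectral_norm M \<in> singular_values M"
    using singular_value_of_eigenvector[OF w(1), of "spectral_norm M" M] eigenvector_of_extremum[OF w(1), of M]
      norm_matrix_vector_mult_le[of M] unfolding w(2) by blast
  have max: "spectral_norm M \<le> sigma_max M"
    unfolding sigma_max_def using norm_sv by (intro Max_ge finite_singular_values)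
  have min: "sigma_min M \<le> \<mu>"
    unfolding sigma_min_def using \<mu>_sv by (intro Min_le finite_singular_values)
  have "sigma_min M \<in> singular_values M"
    unfolding sigma_min_def using \<mu>_sv by (intro Min_in finite_singular_values) auto
  then obtain z y where z: "0 \<le> sigma_min M" "norm z = 1" "M *v z = sigma_min M *\<^sub>R y"
    unfolding singular_values_def by blast
  \<comment> \<open>A singular value 0 would put the unit vector \<open>z\<close> into the kernel of
    the injective \<open>M\<close>.\<close>
  then have pos: "0 < sigma_min M"
    using ker[of z] by (cases "sigma_min M = 0") auto
  have "spectral_norm M * norm x \<le> sigma_max M * norm x"
    using max by (simp add: mult_right_mono)
  also have "\<dots> = kappa2 M * (sigma_min M * norm x)"
    using pos by (simp add: kappa2_def)
  also have "\<dots> \<le> kappa2 M * norm (M *v x)"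
  proof (rule mult_left_mono)
    show "sigma_min M * norm x \<le> norm (M *v x)"
      using min lower[of x] by (meson mult_right_mono norm_ge_zero order_trans)
    show "0 \<le> kappa2 M"
      using pos max spectral_norm_nonneg[of M] by (simp add: kappa2_def)
  qed
  finally show ?thesis .
qed

subsection \<open>Rounding errors of the sketch-and-apply algorithm\<close>

lemma gam_pos:
  assumes "0 < u" "0 < k" "real k * u < 1"
  shows "0 < gam u k" "real k * u \<le> gam u k"
proof -
  have "0 < real k * u" using assms by simp
  then show "0 < gam u k" "real k * u \<le> gam u k"
    using assms by (auto simp: gam_def field_simps)
qed

lemma gamt_eq_gam: "gamt c u k = gam u (c * k)"
  by (simp add: gamt_def gam_def)

lemma gam_column_bound:
  assumes n: "n \<ge> 1" and u: "u > 0" and small: "(real n)\<^sup>2 * u < 1 / 201"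
  shows "0 < gam u n" and "real n * gam u n \<le> 201 / 200 * ((real n)\<^sup>2 * u)"
proof -
  have "real n * u \<le> (real n)\<^sup>2 * u"
    using n u by (simp add: power2_eq_square)
  then have d: "200 / 201 \<le> 1 - real n * u" using small by simp
  then show "0 < gam u n" using n u by (intro gam_pos) auto
  have "real n * gam u n = (real n)\<^sup>2 * u / (1 - real n * u)"
    by (simp add: gam_def power2_eq_square)
  also have "\<dots> \<le> (real n)\<^sup>2 * u / (200 / 201)"
    using d u by (intro divide_left_mono) auto
  finally show "real n * gam u n \<le> 201 / 200 * ((real n)\<^sup>2 * u)" by simp
qed

text \<open>Multiplying \<open>m / n + sqrt n\<close> by \<open>n\<^sup>2 * u\<close> yields
  \<open>n * (m * u) + sqrt n * (n\<^sup>2 * u)\<close>. As \<open>n < s\<close> and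
  \<open>c \<ge> 1\<close>, these two terms lie below the product and the QR contributions to
  \<open>C1\<close>.\<close>

lemma C1_lower_bound:
  assumes u: "u > 0" and n: "n \<ge> 1" and sn: "n < s" and sm: "s < m" and c: "c \<ge> 1"
    and mu: "real m * u < 1" and cu: "real (c * s * n) * u < 1"
    and shape: "real m / real n + sqrt (real n) > 200"
  shows "200 * ((real n)\<^sup>2 * u) < C1 c u m s n"
proof -
  have gm: "real m * u \<le> gam u m" using u sm mu by (intro gam_pos) auto
  have "real s * real n * u \<le> real c * real s * real n * u"
    using c u mult_right_mono[of 1 "real c" "real s * real n * u"] by (simp add: mult_ac)
  also have "\<dots> \<le> gamt c u (s * n)"
    using gam_pos(2)[of u "c * (s * n)"] u n sn c cu by (simp add: gamt_eq_gam mult_ac)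
  finally have gt: "real n * real n * u \<le> gamt c u (s * n)"
    using sn u n by (smt (verit, best) mult_right_mono of_nat_0_le_iff of_nat_mono less_imp_le mult_nonneg_nonneg)
  have sq: "real n \<le> sqrt (real (s * n))"
    using sn by (intro real_le_rsqrt) (simp add: power2_eq_square mult_right_mono)
  have g0: "0 \<le> gam u m" "0 \<le> gamt c u (s * n)"
    using gm gt u by (meson mult_nonneg_nonneg of_nat_0_le_iff less_imp_le order_trans)+
  have "200 * ((real n)\<^sup>2 * u) < (real m / real n + sqrt (real n)) * ((real n)\<^sup>2 * u)"
    using shape u n by (intro mult_strict_right_mono) auto
  also have "\<dots> = real n * (real m * u) + sqrt (real n) * (real n * real n * u)"
    using n by (simp add: field_simps power2_eq_square)
  also have "\<dots> \<le> sqrt (real (s * n)) * gam u m + sqrt (real n) * gamt c u (s * n)"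
    using gm gt sq g0 u by (intro add_mono mult_mono) auto
  also have "\<dots> \<le> C1 c u m s n"
    using g0 unfolding C1_def by (simp add: distrib_left)
  finally show ?thesis .
qed

text \<open>\<open>E\<close> is the sum of the product error and the QR error. The QR error is
  relative to the Frobenius norm of \<open>Bhat\<close>, and passing to the spectral norm gives the
  factor \<open>sqrt n\<close> in \<open>C1\<close>.\<close>

lemma computed_triangular_factor_error:
  fixes A :: "real^('n::{finite,linorder})^'m" and S :: "real^'m^'s"
  assumes prod: "computed_product u S A Bhat" and qr: "computed_QR_factor c u Bhat Rhat"
    and g: "0 \<le> gamt c u (CARD('s) * CARD('n))"
  obtains Qt :: "real^('n::{finite,linorder})^'s" and E where "orthonormal_columns Qt" "Qt ** Rhat = S ** A + E"
    "spectral_norm E \<le> C1 c u CARD('m) CARD('s) CARD('n) * (spectral_norm S * spectral_norm A)"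
proof -
  define g1 where "g1 = sqrt (real (CARD('s) * CARD('n))) * gam u CARD('m)"
  define g2 where "g2 = gamt c u (CARD('s) * CARD('n))"
  define a where "a = spectral_norm S * spectral_norm A"
  obtain E1 where E1: "Bhat = S ** A + E1" "spectral_norm E1 \<le> g1 * a"
    using prod unfolding computed_product_def g1_def a_def by (auto simp: mult_ac)
  obtain Qt :: "real^('n::{finite,linorder})^'s" and E2 where E2: "orthonormal_columns Qt" "Qt ** Rhat = Bhat + E2"
    "frobenius_norm E2 \<le> g2 * frobenius_norm Bhat"
    using qr unfolding computed_QR_factor_def g2_def by blast
  have "spectral_norm Bhat \<le> a + g1 * a"
    using spectral_norm_add_le[of "S ** A" E1] spectral_norm_mult_le[of S A] E1 by (simp add: a_def)
  then have "frobenius_norm Bhat \<le> sqrt (real CARD('n)) * (a + g1 * a)"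
    using frobenius_norm_le_sqrt_spectral_norm[of Bhat] by (meson mult_left_mono order_trans real_sqrt_ge_zero of_nat_0_le_iff)
  then have "frobenius_norm E2 \<le> g2 * (sqrt (real CARD('n)) * (a + g1 * a))"
    using E2(3) g unfolding g2_def[symmetric] by (meson mult_left_mono order_trans)
  then have "spectral_norm (E1 + E2) \<le> g1 * a + g2 * (sqrt (real CARD('n)) * (a + g1 * a))"
    using spectral_norm_add_le[of E1 E2] spectral_norm_le_frobenius_norm[of E2] E1(2) by linarith
  also have "\<dots> = C1 c u CARD('m) CARD('s) CARD('n) * a"
    by (simp add: C1_def g1_def g2_def algebra_simps)
  finally show ?thesis
    using that[OF E2(1), of "E1 + E2"] E1(1) E2(2) by (simp add: a_def add.assoc)
qed

text \<open>Row \<open>i\<close> of the residual is \<open>- (transpose \<Delta> *v Y $ i)\<close>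
  with the backward error of that row. Estimating \<open>Y ** R - A\<close> avoids an inverse of
  \<open>R\<close>; the factor \<open>n\<close> is \<open>sqrt n\<close> twice, from the Frobenius
  norms of \<open>R\<close> and of \<open>Y\<close>.\<close>

lemma forward_substitution_residual:
  fixes A :: "real^'n^'m" and R :: "real^'n^'n"
  assumes fs: "computed_forward_substitution u A R Y" and g: "0 \<le> gam u CARD('n)"
  shows "spectral_norm (Y ** R - A) \<le> real CARD('n) * gam u CARD('n) * spectral_norm R * spectral_norm Y"
proof -
  define g' where "g' = gam u CARD('n)"
  have row: "norm ((Y ** R - A) $ i) \<le> g' * frobenius_norm R * norm (Y $ i)" for i
  proof -
    obtain \<Delta> :: "real^'n^'n" where \<Delta>: "row i Y v* (R + \<Delta>) = row i A" "\<bar>\<Delta>\<bar> \<le> g' *\<^sub>R \<bar>R\<bar>"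
      using fs unfolding computed_forward_substitution_def g'_def by blast
    have "(Y ** R - A) $ i = Y $ i v* R - row i Y v* (R + \<Delta>)"
      unfolding \<Delta>(1) by (simp add: vec_eq_iff row_def matrix_matrix_mult_def vector_matrix_mult_def mult.commute)
    also have "\<dots> = - (transpose \<Delta> *v Y $ i)"
      by (simp add: row_def vec_lambda_eta vector_matrix_mult_def vec_eq_iff sum.distrib algebra_simps sum_negf)
    finally have "norm ((Y ** R - A) $ i) \<le> spectral_norm (transpose \<Delta>) * norm (Y $ i)"
      using norm_matrix_vector_mult_le[of "transpose \<Delta>" "Y $ i"] by simp
    also have "\<dots> \<le> frobenius_norm \<Delta> * norm (Y $ i)"
      by (intro mult_right_mono order_trans[OF spectral_norm_transpose_le spectral_norm_le_frobenius_norm]) simp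
    also have "frobenius_norm \<Delta> \<le> frobenius_norm (g' *\<^sub>R R)"
    proof -
      have "norm (\<Delta> $ k) \<le> norm ((g' *\<^sub>R R) $ k)" for k
        using \<Delta>(2) g unfolding g'_def[symmetric]
        by (intro norm_le_componentwise_cart) (simp add: less_eq_vec_def abs_vec_def abs_mult)
      then show ?thesis
        unfolding norm_vec_def[where x = \<Delta>] norm_vec_def[where x = "g' *\<^sub>R R"]
        by (intro L2_set_mono) auto
    qed
    finally show ?thesis
      using g by (simp add: g'_def mult_right_mono)
  qed
  have "spectral_norm (Y ** R - A) \<le> frobenius_norm (Y ** R - A)"
    by (rule spectral_norm_le_frobenius_norm)
  also have "\<dots> \<le> frobenius_norm ((g' * frobenius_norm R) *\<^sub>R Y)"
    unfolding norm_vec_def[where x = "Y ** R - A"] norm_vec_def[where x = "(g' * frobenius_norm R) *\<^sub>R Y"]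
    using row g by (intro L2_set_mono) (auto simp: g'_def)
  also have "\<dots> = g' * (frobenius_norm R * frobenius_norm Y)"
    using g by (simp add: g'_def)
  also have "\<dots> \<le> g' * ((sqrt (real CARD('n)) * spectral_norm R) * (sqrt (real CARD('n)) * spectral_norm Y))"
    using g unfolding g'_def
    by (intro mult_left_mono mult_mono frobenius_norm_le_sqrt_spectral_norm) (auto simp: spectral_norm_nonneg)
  also have "\<dots> = real CARD('n) * g' * spectral_norm R * spectral_norm Y"
    by simp
  finally show ?thesis by (simp add: g'_def)
qed

text \<open>A minimum over all vectors, attained at \<open>T *v x\<close>, is also one over the
  range of \<open>T\<close>.\<close>

lemma least_squares_solution_mult:
  assumes "least_squares_solution N d (T *v x)"
  shows "least_squares_solution (N ** T) d x"
  using assms by (simp add: least_squares_solution_def matrix_vector_mul_assoc[symmetric])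

theorem theorem3p5:
  fixes A :: "real^('n::{finite,linorder})^'m"
    and S :: "real^'m^'s"
    and b \<delta>b :: "real^'m"
    and Q\<^sub>A :: "real^('n::{finite,linorder})^'m" and R\<^sub>A :: "real^('n::{finite,linorder})^('n::{finite,linorder})"
    and Bhat :: "real^('n::{finite,linorder})^'s" and Rhat :: "real^('n::{finite,linorder})^('n::{finite,linorder})"
    and Yhat \<Delta>Yhat :: "real^('n::{finite,linorder})^'m"
    and zhat xhat :: "real^('n::{finite,linorder})"
    and u :: real and c :: nat
  assumes "CARD('m) > CARD('s)" and "CARD('s) > CARD('n)" and "CARD('n) \<ge> 1"
    and "lin_indep_columns A"
    and "lin_indep_rows S"
    and "rank (S ** A) = CARD('n)"
    and "economized_QR A Q\<^sub>A R\<^sub>A"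
    and "u > 0" and "c \<ge> 1"
    and "real CARD('m) * u < 1"
    and "real (c * CARD('s) * CARD('n)) * u < 1"
    and "kappa2 (S ** Q\<^sub>A) < 49"
    and "(real CARD('n))\<^sup>2 * u < 1 / 201"
    and "real CARD('m) / real CARD('n) + sqrt (real CARD('n)) > 200"
    and "kappa2 A < 1 / (3 * C1 c u CARD('m) CARD('s) CARD('n) * k_sketch S Q\<^sub>A)"
    and "computed_product u S A Bhat"
    and "computed_QR_factor c u Bhat Rhat"
    and "computed_forward_substitution u A Rhat Yhat"
    and "zhat = pinv (Yhat + \<Delta>Yhat) *v (b + \<delta>b)"
    and "computed_back_substitution u Rhat zhat xhat"
  shows "\<exists>\<Delta>A :: real^('n::{finite,linorder})^'m.
           least_squares_solution (A + \<Delta>A) (b + \<delta>b) xhat \<and>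
           spectral_norm \<Delta>A < spectral_norm S * spectral_norm A *
             (6.04 * real CARD('n) * gam u CARD('n) * spectral_norm (pinv (S ** Q\<^sub>A))
              + 2.01 * spectral_norm \<Delta>Yhat)"
proof -
  define n where "n = real CARD('n)"
  define \<gamma> where "\<gamma> = gam u CARD('n)"
  define C where "C = C1 c u CARD('m) CARD('s) CARD('n)"
  define \<kappa> where "\<kappa> = kappa2 A"
  define a where "a = spectral_norm S * spectral_norm A"
  define p where "p = spectral_norm (pinv (S ** Q\<^sub>A))"
  define k where "k = spectral_norm S * p"

  \<comment> \<open>Size of the rounding constants\<close>
  have n1: "1 \<le> n" using assms(3) by (simp add: n_def)
  have small: "n\<^sup>2 * u < 1 / 201" using assms(13) by (simp add: n_def)
  have \<gamma>: "0 < \<gamma>" "n * \<gamma> \<le> 201 / 200 * (n\<^sup>2 * u)"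
    using gam_column_bound[OF assms(3,8,13)] by (simp_all add: n_def \<gamma>_def)
  have n\<gamma>: "0 < n * \<gamma>" "n * \<gamma> < 1 / 200"
    using \<gamma> n1 small by auto
  have C: "200 * (n\<^sup>2 * u) < C"
    unfolding C_def n_def by (rule C1_lower_bound[OF assms(8,3,2,1,9-11,14)])
  \<comment> \<open>201/40000 is 201/200 divided by 200.\<close>
  have n\<gamma>C: "n * \<gamma> < 201 / 40000 * C" using C \<gamma>(2) by linarith
  have C0: "0 < C" using n\<gamma>C n\<gamma>(1) by simp
  have g2: "0 \<le> gamt c u (CARD('s) * CARD('n))"
    using gam_pos(1)[of u "c * (CARD('s) * CARD('n))"] assms(8,9,11)
    by (simp add: gamt_eq_gam mult_ac)

  \<comment> \<open>Exact factors, sketch and condition number\<close>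
  have QR: "A = Q\<^sub>A ** R\<^sub>A" "orthonormal_columns Q\<^sub>A"
    using assms(7) by (auto simp: economized_QR_def)
  have "inj ((*v) (S ** A))" using assms(6) by (simp add: full_rank_injective)
  then have ker_SA: "x = 0" if "(S ** A) *v x = 0" for x
    using that by (metis injD matrix_vector_mult_0_right)
  have inj_A: "inj ((*v) A)"
    using \<open>inj ((*v) (S ** A))\<close> by (metis (no_types, lifting) injI injD matrix_vector_mul_assoc)
  have inj_RA: "inj ((*v) R\<^sub>A)"
    using inj_A unfolding QR(1) by (metis (no_types, lifting) injI injD matrix_vector_mul_assoc)
  obtain V where V: "R\<^sub>A ** V = mat 1"
    using inj_RA by (metis matrix_left_invertible_injective matrix_left_right_inverse)
  \<comment> \<open>\<open>V\<close> is the inverse of the square matrix \<open>R\<^sub>A\<close>,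
    so \<open>S ** Q\<^sub>A\<close> is the injective \<open>S ** A\<close> times
    \<open>V\<close>.\<close>
  have inj_SQ: "inj ((*v) (S ** Q\<^sub>A))"
  proof -
    have "x = 0" if "(S ** Q\<^sub>A) *v x = 0" for x
    proof -
      have "(S ** A) *v (V *v x) = (S ** Q\<^sub>A) *v ((R\<^sub>A ** V) *v x)"
        by (simp only: QR(1) matrix_vector_mul_assoc matrix_mul_assoc)
      then have "V *v x = 0" using that V ker_SA by simp
      then show "x = 0" using V by (metis matrix_vector_mul_assoc matrix_vector_mul_lid matrix_vector_mult_0_right)
    qed
    then show ?thesis by (simp add: vec.inj_iff_eq_0)
  qed
  have sketch: "norm x \<le> p * norm (S *v (Q\<^sub>A *v x))" for x
  proof -
    have "x = pinv (S ** Q\<^sub>A) *v (S *v (Q\<^sub>A *v x))"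
      by (simp add: matrix_vector_mul_assoc pinv_left_inverse[OF inj_SQ] flip: matrix_mul_assoc)
    then show ?thesis unfolding p_def by (metis norm_matrix_vector_mult_le)
  qed
  \<comment> \<open>One unit vector yields \<open>1 \<le> k\<close> and
    \<open>1 \<le> \<kappa>\<close>, as well as the positivity of \<open>p\<close> and of the norms
    of \<open>S\<close> and \<open>A\<close>.\<close>
  obtain e :: "real^('n::{finite,linorder})" where e: "norm e = 1" using vector_choose_size[of 1] by auto
  have "norm (S *v (Q\<^sub>A *v e)) \<le> spectral_norm S"
    using norm_matrix_vector_mult_le[of S "Q\<^sub>A *v e"] e by (simp add: norm_orthonormal_columns_mult[OF QR(2)])
  then have "p * norm (S *v (Q\<^sub>A *v e)) \<le> p * spectral_norm S"
    by (rule mult_left_mono) (simp add: p_def spectral_norm_nonneg)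
  then have "1 \<le> p * spectral_norm S"
    using sketch[of e] e by simp
  then have k1: "1 \<le> k" by (simp add: k_def mult.commute)
  have p0: "0 < p"
    using k1 spectral_norm_nonneg[of "pinv (S ** Q\<^sub>A)"] by (auto simp: k_def p_def order_le_less)
  have S0: "0 < spectral_norm S"
    using k1 spectral_norm_nonneg[of S] by (auto simp: k_def order_le_less)
  have Ae: "0 < norm (A *v e)"
    using inj_A e by (metis injD matrix_vector_mult_0_right norm_zero zero_less_norm_iff zero_neq_one)
  then have A0: "0 < spectral_norm A"
    using norm_matrix_vector_mult_le[of A e] e by (metis mult.right_neutral order_less_le_trans)
  have a0: "0 < a" using S0 A0 by (simp add: a_def)
  have \<kappa>: "spectral_norm A * norm x \<le> \<kappa> * norm (A *v x)" for x
    unfolding \<kappa>_def by (rule spectral_norm_le_kappa2[OF inj_A])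
  have \<kappa>1: "1 \<le> \<kappa>"
  proof -
    have "norm (A *v e) \<le> \<kappa> * norm (A *v e)"
      using \<kappa>[of e] norm_matrix_vector_mult_le[of A e] e by simp
    then show ?thesis using Ae by simp
  qed
  have "\<kappa> < 1 / (3 * C * k)"
    using assms(15) by (simp add: \<kappa>_def C_def k_def k_sketch_def p_def)
  then have "\<kappa> * (3 * C * k) < 1"
    using C0 k1 by (simp add: less_divide_eq)
  then have Ck\<kappa>: "C * (k * \<kappa>) < 1 / 3" by (simp add: mult_ac)
  have k\<kappa>: "1 \<le> k * \<kappa>" using k1 \<kappa>1 mult_mono[of 1 k 1 \<kappa>] by simp
  have "C * 1 \<le> C * (k * \<kappa>)"
    using k\<kappa> C0 by (intro mult_left_mono) auto
  then have C3: "C < 1 / 3"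
    using Ck\<kappa> by linarith

  \<comment> \<open>Bounds for the computed triangular factor and its inverse\<close>
  obtain Qt :: "real^('n::{finite,linorder})^'s" and E where Qt: "orthonormal_columns Qt" "Qt ** Rhat = S ** A + E"
    and E: "spectral_norm E \<le> C * a"
    using computed_triangular_factor_error[OF assms(16,17) g2] unfolding C_def a_def by metis
  have norm_R: "norm (Rhat *v x) = norm (S *v (A *v x) + E *v x)" for x
  proof -
    have "norm (Rhat *v x) = norm (Qt *v (Rhat *v x))"
      by (simp add: norm_orthonormal_columns_mult[OF Qt(1)])
    also have "Qt *v (Rhat *v x) = S *v (A *v x) + E *v x"
      by (simp add: matrix_vector_mul_assoc Qt(2) matrix_vector_mult_add_rdistrib)
    finally show ?thesis .
  qed
  have R_upper: "spectral_norm Rhat \<le> 4 / 3 * a"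
  proof -
    have "spectral_norm Rhat \<le> spectral_norm (S ** A + E)"
      by (rule onorm_le) (metis Qt norm_matrix_vector_mult_le matrix_vector_mul_assoc norm_orthonormal_columns_mult)
    also have "\<dots> \<le> a + C * a"
      using spectral_norm_add_le[of "S ** A" E] spectral_norm_mult_le[of S A] E by (simp add: a_def)
    also have "\<dots> \<le> 4 / 3 * a" using C3 a0 by (simp add: field_simps)
    finally show ?thesis .
  qed
  have R_lower: "norm (A *v x) \<le> 3 / 2 * p * norm (Rhat *v x)" for x
  proof -
    have "norm (A *v x) = norm (R\<^sub>A *v x)"
      by (simp add: QR(1) matrix_vector_mul_assoc[symmetric] norm_orthonormal_columns_mult[OF QR(2)])
    also have "\<dots> \<le> p * norm (S *v (A *v x))"
      using sketch[of "R\<^sub>A *v x"] by (simp add: QR(1) matrix_vector_mul_assoc[symmetric])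
    also have "norm (S *v (A *v x)) \<le> norm (Rhat *v x) + norm (E *v x)"
      unfolding norm_R using norm_triangle_ineq4[of "S *v (A *v x) + E *v x" "E *v x"] by simp
    also have "norm (E *v x) \<le> C * a * norm x"
      using norm_matrix_vector_mult_le[of E x] E by (meson mult_right_mono norm_ge_zero order_trans)
    also have "C * a * norm x = C * spectral_norm S * (spectral_norm A * norm x)"
      by (simp add: a_def)
    also have "\<dots> \<le> C * spectral_norm S * (\<kappa> * norm (A *v x))"
      using C0 S0 by (intro mult_left_mono \<kappa>) auto
    finally have "norm (A *v x) \<le> p * (norm (Rhat *v x) + C * spectral_norm S * (\<kappa> * norm (A *v x)))"
      using p0 by simp
    also have "\<dots> = p * norm (Rhat *v x) + C * (k * \<kappa>) * norm (A *v x)"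
      by (simp add: k_def algebra_simps)
    \<comment> \<open>Absorbing a third of \<open>norm (A *v x)\<close> into the left side leaves
      the factor 3/2.\<close>
    also have "\<dots> \<le> p * norm (Rhat *v x) + 1 / 3 * norm (A *v x)"
      using Ck\<kappa> by (intro add_left_mono mult_right_mono) auto
    finally show ?thesis by simp
  qed
  have "inj ((*v) Rhat)"
  proof -
    have "x = 0" if "Rhat *v x = 0" for x
      using R_lower[of x] that inj_A by (simp add: vec.inj_iff_eq_0)
    then show ?thesis by (simp add: vec.inj_iff_eq_0)
  qed
  then obtain W where W: "Rhat ** W = mat 1"
    by (metis matrix_left_invertible_injective matrix_left_right_inverse)
  have RW: "Rhat *v (W *v x) = x" for x
    by (simp add: matrix_vector_mul_assoc W)
  have AW: "spectral_norm (A ** W) \<le> 3 / 2 * p"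
    using R_lower[of "W *v _"] by (intro onorm_le) (simp add: RW flip: matrix_vector_mul_assoc)
  \<comment> \<open>Together with \<open>R_upper\<close> this bounds the condition number of
    \<open>Rhat\<close> by \<open>4/3 * 3/2 * (k * \<kappa>) = 2 * (k * \<kappa>)\<close>.\<close>
  have W_le: "a * spectral_norm W \<le> 3 / 2 * (k * \<kappa>)"
  proof -
    have "norm (W *v x) \<le> 3 / 2 * (k * \<kappa>) / a * norm x" for x
    proof -
      have "spectral_norm A * norm (W *v x) \<le> \<kappa> * norm (A *v (W *v x))" by (rule \<kappa>)
      also have "\<dots> \<le> \<kappa> * (3 / 2 * p * norm x)"
        using \<kappa>1 R_lower[of "W *v x"] by (intro mult_left_mono) (auto simp: RW)
      finally have "spectral_norm S * (spectral_norm A * norm (W *v x)) \<le> spectral_norm S * (\<kappa> * (3 / 2 * p * norm x))"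
        using S0 by simp
      then have "norm (W *v x) * a \<le> 3 / 2 * (k * \<kappa>) * norm x"
        by (simp add: a_def k_def mult_ac)
      then have "norm (W *v x) \<le> 3 / 2 * (k * \<kappa>) * norm x / a"
        using a0 by (simp only: pos_le_divide_eq)
      then show ?thesis by simp
    qed
    then have "spectral_norm W \<le> 3 / 2 * (k * \<kappa>) / a" by (rule onorm_le)
    then show ?thesis using a0 by (simp add: field_simps)
  qed

  \<comment> \<open>Norm of the computed \<open>Yhat\<close>\<close>
  define G where "G = Yhat ** Rhat - A"
  define r where "r = spectral_norm Rhat"
  define y where "y = spectral_norm Yhat"
  define d where "d = spectral_norm \<Delta>Yhat"
  have nonneg: "0 \<le> r" "0 \<le> y" "0 \<le> d" by (simp_all add: r_def y_def d_def spectral_norm_nonneg)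
  have G: "spectral_norm G \<le> n * \<gamma> * r * y"
    using forward_substitution_residual[OF assms(18)] \<gamma>(1)
    by (simp add: G_def n_def \<gamma>_def r_def y_def)
  \<comment> \<open>The residual bound contains \<open>y\<close> itself. The resulting inequality
    \<open>y \<le> 3/2 * p + y / 200\<close> is solved for \<open>y\<close>, and 3/2 times 200/199
    is 300/199.\<close>
  have y_le: "y \<le> 300 / 199 * p"
  proof -
    have "Yhat = A ** W + G ** W"
    proof -
      have "A + G = Yhat ** Rhat" by (simp add: G_def)
      then have "(A + G) ** W = Yhat" by (metis W matrix_mul_assoc matrix_mul_rid)
      then show ?thesis by (simp add: matrix_mult_add_rdistrib)
    qed
    then have "y \<le> spectral_norm (A ** W) + spectral_norm (G ** W)"
      unfolding y_def by (metis spectral_norm_add_le)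
    also have "spectral_norm (G ** W) \<le> n * \<gamma> * r * y * spectral_norm W"
      using spectral_norm_mult_le[of G W] G by (meson mult_right_mono order_trans spectral_norm_nonneg)
    also have "\<dots> = n * \<gamma> * y * (r * spectral_norm W)" by simp
    also have "\<dots> \<le> n * \<gamma> * y * (4 / 3 * (3 / 2 * (k * \<kappa>)))"
    proof (intro mult_left_mono)
      have "r * spectral_norm W \<le> 4 / 3 * a * spectral_norm W"
        using R_upper unfolding r_def by (rule mult_right_mono) (rule spectral_norm_nonneg)
      then show "r * spectral_norm W \<le> 4 / 3 * (3 / 2 * (k * \<kappa>))" using W_le by linarith
      show "0 \<le> n * \<gamma> * y" using n\<gamma>(1) nonneg by simp
    qed
    also have "\<dots> = 2 * (n * \<gamma>) * (k * \<kappa>) * y" by simp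
    also have "\<dots> \<le> 1 / 200 * y"
    proof (intro mult_right_mono nonneg)
      \<comment> \<open>Trading \<open>n * \<gamma>\<close> for \<open>C\<close> brings in
        \<open>C * (k * \<kappa>) < 1/3\<close>; a third of 201/20000 is below 1/200.\<close>
      have "2 * (n * \<gamma>) * (k * \<kappa>) \<le> 201 / 20000 * (C * (k * \<kappa>))"
        using mult_right_mono[of "n * \<gamma>" "201 / 40000 * C" "k * \<kappa>"] n\<gamma>C k\<kappa> by simp
      then show "2 * (n * \<gamma>) * (k * \<kappa>) \<le> 1 / 200" using Ck\<kappa> by linarith
    qed
    finally show ?thesis using AW by simp
  qed

  \<comment> \<open>Backward error from back substitution and LSQR\<close>
  obtain \<Delta>R where \<Delta>R: "(Rhat + \<Delta>R) *v xhat = zhat" "spectral_norm \<Delta>R \<le> \<gamma> * sqrt n * r"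
    using assms(20) unfolding computed_back_substitution_def \<gamma>_def n_def r_def by blast
  \<comment> \<open>Weakening \<open>sqrt n\<close> to \<open>n\<close> gives the back substitution
    error the same factor \<open>n * \<gamma> * r\<close> as the forward substitution
    residual.\<close>
  have "sqrt n \<le> n" using n1 by (simp add: real_le_lsqrt power2_eq_square mult_le_cancel_left1)
  then have "\<gamma> * sqrt n * r \<le> \<gamma> * n * r"
    using \<gamma>(1) nonneg(1) by (intro mult_right_mono mult_left_mono) auto
  then have \<Delta>R_le: "spectral_norm \<Delta>R \<le> n * \<gamma> * r"
    unfolding mult.commute[of n \<gamma>] by (rule order_trans[OF \<Delta>R(2)])

  define \<Delta>A where "\<Delta>A = (Yhat + \<Delta>Yhat) ** (Rhat + \<Delta>R) - A"
  have "least_squares_solution (Yhat + \<Delta>Yhat) (b + \<delta>b) ((Rhat + \<Delta>R) *v xhat)"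
    unfolding \<Delta>R(1) assms(19) by (rule least_squares_solution_pinv)
  then have ls: "least_squares_solution (A + \<Delta>A) (b + \<delta>b) xhat"
    by (simp add: \<Delta>A_def least_squares_solution_mult)

  have \<Delta>A: "\<Delta>A = G + (\<Delta>Yhat ** Rhat + (Yhat + \<Delta>Yhat) ** \<Delta>R)"
    by (simp add: \<Delta>A_def G_def matrix_add_ldistrib matrix_mult_add_rdistrib)
  have "spectral_norm \<Delta>A
      \<le> spectral_norm G + (spectral_norm (\<Delta>Yhat ** Rhat) + spectral_norm ((Yhat + \<Delta>Yhat) ** \<Delta>R))"
    unfolding \<Delta>A using spectral_norm_add_le[of G "\<Delta>Yhat ** Rhat + (Yhat + \<Delta>Yhat) ** \<Delta>R"]
      spectral_norm_add_le[of "\<Delta>Yhat ** Rhat" "(Yhat + \<Delta>Yhat) ** \<Delta>R"] by linarith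
  also have "\<dots> \<le> n * \<gamma> * r * y + (d * r + (y + d) * (n * \<gamma> * r))"
  proof (intro add_mono G)
    show "spectral_norm (\<Delta>Yhat ** Rhat) \<le> d * r"
      unfolding d_def r_def by (rule spectral_norm_mult_le)
    have "spectral_norm (Yhat + \<Delta>Yhat) \<le> y + d"
      unfolding y_def d_def by (rule spectral_norm_add_le)
    then show "spectral_norm ((Yhat + \<Delta>Yhat) ** \<Delta>R) \<le> (y + d) * (n * \<gamma> * r)"
      using \<Delta>R_le nonneg
      by (intro order_trans[OF spectral_norm_mult_le] mult_mono) (auto simp: spectral_norm_nonneg)
  qed
  also have "\<dots> = r * (2 * (n * \<gamma>) * y + (1 + n * \<gamma>) * d)"
    by (simp add: algebra_simps)
  also have "\<dots> \<le> (4 / 3 * a) * (2 * (n * \<gamma>) * (300 / 199 * p) + (1 + 1 / 200) * d)"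
  proof (rule mult_mono)
    show "2 * (n * \<gamma>) * y + (1 + n * \<gamma>) * d \<le> 2 * (n * \<gamma>) * (300 / 199 * p) + (1 + 1 / 200) * d"
      using n\<gamma> by (intro add_mono mult_left_mono[OF y_le] mult_right_mono[OF _ nonneg(3)]) linarith+
    show "0 \<le> 2 * (n * \<gamma>) * y + (1 + n * \<gamma>) * d"
      using n\<gamma> nonneg
      by (intro add_nonneg_nonneg mult_nonneg_nonneg[OF _ nonneg(2)] mult_nonneg_nonneg[OF _ nonneg(3)])
        linarith+
  qed (use R_upper a0 in \<open>auto simp: r_def\<close>)
  \<comment> \<open>The coefficients are 800/199, below 6.04, and 1.34, below 2.01. Strictness comes
    from the first term, as \<open>d\<close> may be 0.\<close>
  also have "\<dots> < a * (6.04 * (n * \<gamma>) * p + 2.01 * d)"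
  proof -
    have "0 < n * \<gamma> * p" using n\<gamma>(1) p0 by simp
    then have "4 / 3 * (2 * (n * \<gamma>) * (300 / 199 * p) + (1 + 1 / 200) * d) < 6.04 * (n * \<gamma>) * p + 2.01 * d"
      using nonneg(3) by (simp add: algebra_simps)
    then have "a * (4 / 3 * (2 * (n * \<gamma>) * (300 / 199 * p) + (1 + 1 / 200) * d)) < a * (6.04 * (n * \<gamma>) * p + 2.01 * d)"
      using a0 by (rule mult_strict_left_mono)
    then show ?thesis by (simp only: mult.assoc mult.left_commute[of a])
  qed
  finally have "spectral_norm \<Delta>A < a * (6.04 * (n * \<gamma>) * p + 2.01 * d)" .
  then show ?thesis
    using ls by (intro exI[of _ \<Delta>A])
      (simp only: a_def n_def \<gamma>_def p_def d_def mult.assoc simp_thms)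
qed

end
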